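(* Let $G$ be a connected pendant-free graph. Then $$\gamma^{\mathrm{EID}}(G)\geq \frac{|V(G)|}{2}.$$
   Context: Graphs are finite and simple, with nonempty edge set. For an edge $e$ of a graph $G$, $N[e]$ denotes the set consisting of $e$ and all edges of $G$ adjacent to $e$ (i.e. sharing an endpoint with $e$). A subset $\mathcal{C}_E\subseteq E(G)$ is an edge-identifying code of $G$ if $N[e]\cap\mathcal{C}_E\neq\emptyset$ for every $e\in E(G)$, and $N[e]\cap\mathcal{C}_E\neq N[f]\cap\mathcal{C}_E$ for all distinct $e,f\in E(G)$. A pair of adjacent edges $ux,uy$ ($x\neq y$) of $G$ is pendant if either both $x$ and $y$ have degree $1$ in $G$, or both $x$ and $y$ have degree $2$ in $G$ and $xy\in E(G)$; $G$ is pendant-free if it has no pendant pair of edges (equivalently, $G$ admits an edge-identifying code). For a pendant-free graph $G$, $\gamma^{\mathrm{EID}}(G)$ is the minimum size of an edge-identifying code of $G$. *)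

theory Defs
  imports Complex_Main "Graph_Theory.Graph_Theory"
begin

text \<open>
  Finite simple graphs are the loop-free symmetric digraphs of locale \<^locale>\<open>pair_graph\<close>.
  An undirected edge is the two-element set of endpoints of an arc, so the two opposite arcs
  between \<open>u\<close> and \<open>v\<close> give the single edge \<open>{u, v}\<close>.
\<close>

definition edges :: "'a pair_pre_digraph \<Rightarrow> 'a set set" where
  "edges G = {{u, v} |u v. (u, v) \<in> parcs G}"

text \<open>
  Every edge at \<open>v\<close> gives exactly one arc leaving \<open>v\<close>; see \<open>degree_eq_card_edges\<close> below.
\<close>

definition degree :: "'a pair_pre_digraph \<Rightarrow> 'a \<Rightarrow> nat" where
  "degree G v = out_degree (with_proj G) v"

definition adjacent_edges :: "'a set \<Rightarrow> 'a set \<Rightarrow> bool" where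
  "adjacent_edges e f \<longleftrightarrow> e \<noteq> f \<and> e \<inter> f \<noteq> {}"

definition closed_edge_nbhd :: "'a pair_pre_digraph \<Rightarrow> 'a set \<Rightarrow> 'a set set" where
  "closed_edge_nbhd G e = insert e {f \<in> edges G. adjacent_edges e f}"

definition edge_identifying_code :: "'a pair_pre_digraph \<Rightarrow> 'a set set \<Rightarrow> bool" where
  "edge_identifying_code G C \<longleftrightarrow>
     C \<subseteq> edges G \<and>
     (\<forall>e \<in> edges G. closed_edge_nbhd G e \<inter> C \<noteq> {}) \<and>
     (\<forall>e \<in> edges G. \<forall>f \<in> edges G. e \<noteq> f \<longrightarrow>
        closed_edge_nbhd G e \<inter> C \<noteq> closed_edge_nbhd G f \<inter> C)"

definition pendant_pair :: "'a pair_pre_digraph \<Rightarrow> 'a set \<Rightarrow> 'a set \<Rightarrow> bool" where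
  "pendant_pair G e f \<longleftrightarrow>
     (\<exists>u x y. e = {u, x} \<and> f = {u, y} \<and> e \<in> edges G \<and> f \<in> edges G \<and> x \<noteq> y \<and>
        (degree G x = 1 \<and> degree G y = 1 \<or>
         degree G x = 2 \<and> degree G y = 2 \<and> {x, y} \<in> edges G))"

definition pendant_free :: "'a pair_pre_digraph \<Rightarrow> bool" where
  "pendant_free G \<longleftrightarrow> (\<nexists>e f. pendant_pair G e f)"

text \<open>
  The minimum exists for every pendant-free graph, by \<open>pendant_free_iff_code\<close> below.
\<close>

definition eid_number :: "'a pair_pre_digraph \<Rightarrow> nat" where
  "eid_number G = (LEAST k. \<exists>C. edge_identifying_code G C \<and> card C = k)"

context pair_graph
begin

lemma arc_sym: "(u, v) \<in> parcs G \<Longrightarrow> (v, u) \<in> parcs G"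
  using pair_sym_arcs by (auto simp: symmetric_def dest: symD)

lemma arc_commute: "(u, v) \<in> parcs G \<longleftrightarrow> (v, u) \<in> parcs G"
  using arc_sym by blast

lemma arc_irrefl: "(u, u) \<notin> parcs G"
  using pair_no_loops by fastforce

lemma edge_iff: "{u, v} \<in> edges G \<longleftrightarrow> (u, v) \<in> parcs G"
  by (auto simp: edges_def doubleton_eq_iff arc_commute)

lemma degree_conv: "degree G v = card {w. (v, w) \<in> parcs G}"
proof -
  have "out_arcs (with_proj G) v = Pair v ` {w. (v, w) \<in> parcs G}"
    by (auto simp: out_arcs_def)
  then show ?thesis
    by (simp add: degree_def out_degree_def card_image inj_on_def)
qed

lemma degree_eq_card_edges: "degree G v = card {e \<in> edges G. v \<in> e}"
proof -
  have "{e \<in> edges G. v \<in> e} = (\<lambda>w. {v, w}) ` {w. (v, w) \<in> parcs G}"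
    by (auto simp: edges_def arc_commute)
  moreover have "inj_on (\<lambda>w. {v, w}) {w. (v, w) \<in> parcs G}"
    by (auto simp: inj_on_def doubleton_eq_iff)
  ultimately show ?thesis
    by (simp add: degree_conv card_image)
qed

lemma closed_edge_nbhd_iff:
  assumes "e \<in> edges G"
  shows "f \<in> closed_edge_nbhd G e \<longleftrightarrow> f \<in> edges G \<and> e \<inter> f \<noteq> {}"
  using assms by (auto simp: closed_edge_nbhd_def adjacent_edges_def edges_def)

lemma same_nbhd_imp_pendant:
  assumes e: "e \<in> edges G" and f: "f \<in> edges G" and ne: "e \<noteq> f"
    and eq: "closed_edge_nbhd G e = closed_edge_nbhd G f"
  shows "pendant_pair G e f"
proof -
  have "f \<in> closed_edge_nbhd G e"
    using eq by (simp add: closed_edge_nbhd_def)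
  then have "e \<inter> f \<noteq> {}"
    using closed_edge_nbhd_iff[OF e] by blast
  then obtain u where u: "u \<in> e" "u \<in> f" by blast
  obtain x where ex: "e = {u, x}"
    using e u(1) by (auto simp: edges_def insert_commute)
  obtain y where fy: "f = {u, y}"
    using f u(2) by (auto simp: edges_def insert_commute)
  have xy: "x \<noteq> y" using ne ex fy by auto
  have ux: "(u, x) \<in> parcs G" and uy: "(u, y) \<in> parcs G"
    using e f ex fy by (simp_all add: edge_iff)
  have ux': "u \<noteq> x" and uy': "u \<noteq> y" using ux uy arc_irrefl by auto
  have mem: "g \<inter> {u, x} \<noteq> {} \<longleftrightarrow> g \<inter> {u, y} \<noteq> {}" if "g \<in> edges G" for g
  proof -
    have "g \<in> closed_edge_nbhd G e \<longleftrightarrow> g \<in> closed_edge_nbhd G f" by (simp add: eq)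
    then show ?thesis
      using that closed_edge_nbhd_iff[OF e] closed_edge_nbhd_iff[OF f] ex fy
      by (simp add: Int_commute)
  qed
  have nx: "z = u \<or> z = y" if "(x, z) \<in> parcs G" for z
    using mem[of "{x, z}"] that xy ux' by (auto simp: edge_iff)
  have ny: "z = u \<or> z = x" if "(y, z) \<in> parcs G" for z
    using mem[of "{y, z}"] that xy uy' by (auto simp: edge_iff)
  show ?thesis
  proof (cases "(x, y) \<in> parcs G")
    case True
    then have "{w. (x, w) \<in> parcs G} = {u, y}" "{w. (y, w) \<in> parcs G} = {u, x}"
      using nx ny ux uy arc_sym by blast+
    then have "degree G x = 2" "degree G y = 2"
      using ux' uy' by (simp_all add: degree_conv)
    then show ?thesis
      unfolding pendant_pair_def using e f ex fy xy edge_iff[of x y] True by blast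
  next
    case False
    then have "{w. (x, w) \<in> parcs G} = {u}" "{w. (y, w) \<in> parcs G} = {u}"
      using nx ny ux uy arc_sym by blast+
    then have "degree G x = 1" "degree G y = 1"
      by (simp_all add: degree_conv)
    then show ?thesis
      unfolding pendant_pair_def using e f ex fy xy by blast
  qed
qed

lemma finite_nbrs: "finite {w. (v, w) \<in> parcs G}"
  by (rule finite_subset[OF _ pair_finite_verts]) (auto dest: in_arcsD2)

lemma pendant_imp_same_nbhd:
  assumes "pendant_pair G e f"
  shows "e \<in> edges G \<and> f \<in> edges G \<and> e \<noteq> f \<and> closed_edge_nbhd G e = closed_edge_nbhd G f"
proof -
  obtain u x y where ex: "e = {u, x}" and fy: "f = {u, y}"
    and e: "e \<in> edges G" and f: "f \<in> edges G" and xy: "x \<noteq> y"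
    and d: "degree G x = 1 \<and> degree G y = 1 \<or>
         degree G x = 2 \<and> degree G y = 2 \<and> {x, y} \<in> edges G"
    using assms unfolding pendant_pair_def by blast
  have ux: "(x, u) \<in> parcs G" and uy: "(y, u) \<in> parcs G"
    using e f ex fy by (simp_all add: edge_iff arc_sym)
  have neq: "u \<noteq> x" "u \<noteq> y" using ux uy arc_irrefl by auto
  have "{w. (x, w) \<in> parcs G} \<subseteq> {u, y} \<and> {w. (y, w) \<in> parcs G} \<subseteq> {u, x}"
    using d
  proof
    assume "degree G x = 1 \<and> degree G y = 1"
    then obtain a b where "{w. (x, w) \<in> parcs G} = {a}" "{w. (y, w) \<in> parcs G} = {b}"
      by (metis degree_conv card_1_singletonE)
    with ux uy show ?thesis by auto
  next
    assume a: "degree G x = 2 \<and> degree G y = 2 \<and> {x, y} \<in> edges G"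
    then have "{u, y} \<subseteq> {w. (x, w) \<in> parcs G}" "{u, x} \<subseteq> {w. (y, w) \<in> parcs G}"
      using ux uy by (auto simp: edge_iff arc_commute)
    moreover have "card {u, y} = 2" "card {u, x} = 2" using neq by auto
    ultimately have "{u, y} = {w. (x, w) \<in> parcs G}" "{u, x} = {w. (y, w) \<in> parcs G}"
      using a by (metis card_subset_eq degree_conv finite_nbrs)+
    then show ?thesis by simp
  qed
  then have "g \<inter> {u, x} \<noteq> {} \<longleftrightarrow> g \<inter> {u, y} \<noteq> {}" if "g \<in> edges G" for g
    using that by (auto simp: edges_def arc_commute)
  then have "closed_edge_nbhd G e = closed_edge_nbhd G f"
    using closed_edge_nbhd_iff[OF e] closed_edge_nbhd_iff[OF f] ex fy
    by (intro set_eqI) (metis Int_commute)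
  then show ?thesis using e f ex fy xy by (auto simp: doubleton_eq_iff)
qed

lemma pendant_free_iff_code: "pendant_free G \<longleftrightarrow> (\<exists>C. edge_identifying_code G C)"
proof
  assume pf: "pendant_free G"
  have "closed_edge_nbhd G e \<inter> edges G = closed_edge_nbhd G e" if "e \<in> edges G" for e
    using that closed_edge_nbhd_iff by blast
  then have "edge_identifying_code G (edges G)"
    using pf same_nbhd_imp_pendant
    by (simp add: edge_identifying_code_def pendant_free_def)
       (metis closed_edge_nbhd_def insert_not_empty)
  then show "\<exists>C. edge_identifying_code G C" ..
next
  assume "\<exists>C. edge_identifying_code G C"
  then show "pendant_free G"
    unfolding pendant_free_def edge_identifying_code_def using pendant_imp_same_nbhd by metis
qed

end

end

theory Submission
  imports Defs
begin

text \<open>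
  Let \<open>C\<close> be an edge-identifying code and split the vertices into the covered ones, those lying
  on an edge of \<open>C\<close>, and the uncovered ones. Two observations about signatures, the sets of code edges in
  a closed neighbourhood, drive the proof. The signature of an edge from \<open>v\<close> to an uncovered vertex
  is the set of code edges at \<open>v\<close>, so \<open>v\<close> has at most one uncovered neighbour. The signature of a
  code edge \<open>vw\<close> whose end \<open>v\<close> lies on no other code edge is the set of code edges at \<open>w\<close>.

  Call a vertex exposed if it has an uncovered neighbour. Uncovered vertices are pairwise
  nonadjacent because every edge has a nonempty signature, and none is isolated because \<open>G\<close> is
  connected and has an edge. Hence there are at most as many uncovered as exposed vertices
  (\<open>card_uncovered_le_card_exposed\<close>), and it suffices to bound the number of covered plus the
  number of exposed vertices by \<open>2 |C|\<close>, the sum over the covered vertices of their degree in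
  \<open>C\<close>. The only vertices whose own degree does not pay for them are the exposed vertices of
  degree 1 in \<open>C\<close>: they cost 2 and have 1. By the second observation the other end of the code
  edge at such a vertex is not exposed and has degree at least 2, so it has a unit to spare, and it
  is not asked for this unit twice (\<open>card_exposed_leaves_le_card_sheltered\<close>).
\<close>

section \<open>Vertices relative to a code\<close>

definition incident :: "'a set set \<Rightarrow> 'a \<Rightarrow> 'a set set" where
  "incident C v = {e \<in> C. v \<in> e}"

definition exposed :: "'a pair_pre_digraph \<Rightarrow> 'a set set \<Rightarrow> 'a set" where
  "exposed G C = {v. \<exists>x. (v, x) \<in> parcs G \<and> incident C x = {}}"

definition exposed_leaves :: "'a pair_pre_digraph \<Rightarrow> 'a set set \<Rightarrow> 'a set" where
  "exposed_leaves G C = {v \<in> exposed G C. card (incident C v) = 1}"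

text \<open>These vertices have a unit of degree to spare in the count described above.\<close>

definition sheltered :: "'a pair_pre_digraph \<Rightarrow> 'a set set \<Rightarrow> 'a set" where
  "sheltered G C = {v \<in> \<Union>C - exposed G C. 2 \<le> card (incident C v)}"

lemma incident_eq_empty_iff: "incident C v = {} \<longleftrightarrow> v \<notin> \<Union>C"
  by (auto simp: incident_def)

section \<open>Edges, degrees and signatures\<close>

context pair_graph
begin

lemma finite_edges: "finite (edges G)"
proof -
  have "edges G = (\<lambda>(u, v). {u, v}) ` parcs G"
    by (auto simp: edges_def)
  then show ?thesis by simp
qed

lemma edge_subset_verts: "e \<in> edges G \<Longrightarrow> e \<subseteq> pverts G"
  by (auto simp: edges_def dest: in_arcsD1 in_arcsD2)

lemma card_edge: "e \<in> edges G \<Longrightarrow> card e = 2"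
  using arc_irrefl by (auto simp: edges_def card_insert_if)

lemma edge_other_end:
  assumes "e \<in> edges G" "v \<in> e"
  obtains w where "e = {v, w}" "(v, w) \<in> parcs G"
proof -
  obtain a b where ab: "e = {a, b}" "(a, b) \<in> parcs G"
    using assms(1) by (auto simp: edges_def)
  then consider "v = a" | "v = b" using assms(2) by auto
  then show thesis
  proof cases
    case 1
    with ab show thesis by (intro that) auto
  next
    case 2
    with ab arc_sym show thesis by (intro that) auto
  qed
qed

lemma connected_no_isolated:
  assumes con: "Digraph_Component.connected (with_proj G)" and ne: "edges G \<noteq> {}"
    and x: "x \<in> pverts G"
  obtains w where "(x, w) \<in> parcs G"
proof -
  obtain a b where ab: "(a, b) \<in> parcs G" using ne by (auto simp: edges_def)
  then have "a \<noteq> b" using arc_irrefl by auto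
  then obtain y where y: "y \<in> pverts G" "y \<noteq> x"
    using ab in_arcsD1 in_arcsD2 by metis
  have "x \<rightarrow>\<^sup>*\<^bsub>with_proj (mk_symmetric (with_proj G))\<^esub> y"
    using con x y by (simp add: Digraph_Component.connected_def strongly_connected_def)
  then obtain z where "x \<rightarrow>\<^bsub>with_proj (mk_symmetric (with_proj G))\<^esub> z"
    using y(2) by (auto elim: pre_digraph.converse_reachable_cases)
  then have "(x, z) \<in> parcs G"
    using arc_sym by (auto simp: parcs_mk_symmetric)
  then show thesis by (rule that)
qed

lemma signature_conv:
  assumes "C \<subseteq> edges G" "(u, v) \<in> parcs G"
  shows "closed_edge_nbhd G {u, v} \<inter> C = incident C u \<union> incident C v"
  using assms closed_edge_nbhd_iff[of "{u, v}"] by (auto simp: edge_iff incident_def)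

text \<open>The handshake identity for the graph formed by the edges in \<open>C\<close>.\<close>

lemma sum_card_incident:
  assumes "C \<subseteq> edges G"
  shows "(\<Sum>v\<in>\<Union>C. card (incident C v)) = 2 * card C"
proof -
  have fin: "finite C" "finite (\<Union>C)"
    using assms finite_edges edge_subset_verts pair_finite_verts
    by (meson finite_subset, meson Union_least finite_subset subsetD)
  have "\<forall>e\<in>C. card {v \<in> \<Union>C. v \<in> e} = 2"
  proof
    fix e assume "e \<in> C"
    then have "{v \<in> \<Union>C. v \<in> e} = e" by auto
    then show "card {v \<in> \<Union>C. v \<in> e} = 2" using \<open>e \<in> C\<close> assms card_edge by auto
  qed
  from sum_multicount[OF fin(2,1) this] show ?thesis
    by (simp add: incident_def)
qed

end

section \<open>Counting the vertices of a graph with an edge-identifying code\<close>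

locale edge_coded_graph = pair_graph +
  fixes C :: "'a set set"
  assumes code: "edge_identifying_code G C"
begin

lemma code_subset: "C \<subseteq> edges G"
  using code by (simp add: edge_identifying_code_def)

lemma finite_code: "finite C"
  using code_subset finite_edges finite_subset by blast

lemma covered_subset_verts: "\<Union>C \<subseteq> pverts G"
  using code_subset edge_subset_verts by blast

lemma finite_covered: "finite (\<Union>C)"
  using covered_subset_verts pair_finite_verts finite_subset by blast

lemma finite_incident: "finite (incident C v)"
  using finite_code by (simp add: incident_def)

lemma arc_dominated: "(u, v) \<in> parcs G \<Longrightarrow> incident C u \<union> incident C v \<noteq> {}"
  using code signature_conv[OF code_subset] edge_iff
  unfolding edge_identifying_code_def by metis

lemma arc_determined_by_signature:
  assumes "(u, v) \<in> parcs G" "(u', v') \<in> parcs G"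
    and "incident C u \<union> incident C v = incident C u' \<union> incident C v'"
  shows "{u, v} = {u', v'}"
  using assms code signature_conv[OF code_subset] edge_iff
  unfolding edge_identifying_code_def by metis

text \<open>An edge between two uncovered vertices would have an empty signature.\<close>

lemma exposed_subset_covered: "exposed G C \<subseteq> \<Union>C"
  using arc_dominated by (fastforce simp: exposed_def incident_eq_empty_iff)

lemma uncovered_neighbour_unique:
  assumes "(v, x) \<in> parcs G" "incident C x = {}" "(v, y) \<in> parcs G" "incident C y = {}"
  shows "x = y"
  using arc_determined_by_signature[of v x v y] assms by (auto simp: doubleton_eq_iff)

text \<open>
  Choosing a neighbour of each uncovered vertex gives an injection into the exposed vertices.
\<close>

lemma card_uncovered_le_card_exposed:
  assumes no_isolated: "\<And>x. x \<in> pverts G \<Longrightarrow> \<exists>w. (x, w) \<in> parcs G"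
  shows "card (pverts G - \<Union>C) \<le> card (exposed G C)"
proof -
  obtain f where f: "\<And>x. x \<in> pverts G \<Longrightarrow> (x, f x) \<in> parcs G"
    using no_isolated by metis
  show ?thesis
  proof (rule card_inj_on_le)
    show "f ` (pverts G - \<Union>C) \<subseteq> exposed G C"
    proof (rule image_subsetI)
      fix x assume "x \<in> pverts G - \<Union>C"
      then have "(f x, x) \<in> parcs G" "incident C x = {}"
        using f arc_sym by (auto simp: incident_eq_empty_iff)
      then show "f x \<in> exposed G C" by (auto simp: exposed_def)
    qed
    show "inj_on f (pverts G - \<Union>C)"
    proof (rule inj_onI)
      fix x y assume xy: "x \<in> pverts G - \<Union>C" "y \<in> pverts G - \<Union>C" "f x = f y"
      then have "(f x, x) \<in> parcs G" "(f x, y) \<in> parcs G"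
        using f[of x] f[of y] arc_sym by auto
      then show "x = y"
        using xy uncovered_neighbour_unique incident_eq_empty_iff by (metis Diff_iff)
    qed
    show "finite (exposed G C)"
      using exposed_subset_covered finite_covered finite_subset by blast
  qed
qed

text \<open>
  Let \<open>vw\<close> be the code edge at an exposed leaf \<open>v\<close>, and \<open>x\<close> the uncovered neighbour of \<open>v\<close>. The
  signature of \<open>vw\<close> is the set of code edges at \<open>w\<close>. It differs from the signature \<open>{vw}\<close> of \<open>vx\<close>,
  so \<open>w\<close> lies on a second code edge, and from that of an edge from \<open>w\<close> to an uncovered vertex, so
  there is no such edge.
\<close>

lemma exposed_leaf_neighbour_sheltered:
  assumes v: "v \<in> exposed_leaves G C"
  obtains w where "(v, w) \<in> parcs G" "incident C v = {{v, w}}" "w \<in> sheltered G C"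
proof -
  obtain x where vx: "(v, x) \<in> parcs G" and x: "incident C x = {}"
    using v by (auto simp: exposed_leaves_def exposed_def)
  obtain e where e: "incident C v = {e}"
    using v by (auto simp: exposed_leaves_def card_1_singleton_iff)
  then have "e \<in> C" "v \<in> e" by (auto simp: incident_def)
  then obtain w where w: "e = {v, w}" "(v, w) \<in> parcs G"
    using code_subset edge_other_end by blast
  have ew: "e \<in> incident C w" using \<open>e \<in> C\<close> w by (simp add: incident_def)
  have "incident C w \<noteq> {e}"
  proof
    assume "incident C w = {e}"
    then have "{v, w} = {v, x}"
      using arc_determined_by_signature[OF w(2) vx] e x by simp
    then have "w = x" by (auto simp: doubleton_eq_iff)
    with ew x show False by simp
  qed
  then have "{e} \<subset> incident C w" using ew by blast
  then have "card {e} < card (incident C w)"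
    by (rule psubset_card_mono[OF finite_incident])
  moreover have "w \<notin> exposed G C"
  proof
    assume "w \<in> exposed G C"
    then obtain y where y: "(w, y) \<in> parcs G" "incident C y = {}"
      by (auto simp: exposed_def)
    then have "{v, w} = {w, y}"
      using arc_determined_by_signature[OF w(2) y(1)] e ew by auto
    then have "v = y" by (auto simp: doubleton_eq_iff)
    with e y show False by simp
  qed
  moreover have "w \<in> \<Union>C" using \<open>e \<in> C\<close> w(1) by blast
  ultimately have "w \<in> sheltered G C" by (simp add: sheltered_def)
  with w e that show thesis by blast
qed

text \<open>
  Sending an exposed leaf to its neighbour in the code is injective: if \<open>w\<close> is the neighbour of
  both \<open>u\<close> and \<open>v\<close>, then the edges \<open>uw\<close> and \<open>vw\<close> have the same signature, the set of code edges
  at \<open>w\<close>.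
\<close>

lemma card_exposed_leaves_le_card_sheltered:
  "card (exposed_leaves G C) \<le> card (sheltered G C)"
proof -
  have "\<exists>w. (v, w) \<in> parcs G \<and> incident C v = {{v, w}} \<and> w \<in> sheltered G C"
    if "v \<in> exposed_leaves G C" for v
    using exposed_leaf_neighbour_sheltered[OF that] by metis
  then obtain f where f: "\<And>v. v \<in> exposed_leaves G C \<Longrightarrow>
      (v, f v) \<in> parcs G \<and> incident C v = {{v, f v}} \<and> f v \<in> sheltered G C"
    by metis
  show ?thesis
  proof (rule card_inj_on_le)
    show "f ` exposed_leaves G C \<subseteq> sheltered G C" using f by blast
    show "inj_on f (exposed_leaves G C)"
    proof (rule inj_onI)
      fix u v
      assume u: "u \<in> exposed_leaves G C" and v: "v \<in> exposed_leaves G C" and uv: "f u = f v"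
      have sig: "incident C z \<union> incident C (f z) = incident C (f z)"
        if "z \<in> exposed_leaves G C" for z
        using f[OF that] by (auto simp: incident_def)
      have "{u, f u} = {v, f v}"
        using f[OF u] f[OF v] sig[OF u] sig[OF v] uv by (intro arc_determined_by_signature) simp_all
      then show "u = v" using uv by (auto simp: doubleton_eq_iff)
    qed
    show "finite (sheltered G C)"
      by (rule finite_subset[OF _ finite_covered]) (auto simp: sheltered_def)
  qed
qed

text \<open>
  At each covered vertex the inequality between summands is a matter of degrees: an exposed vertex
  of degree 1 falls short by 1, which makes it an exposed leaf, and a sheltered vertex, which is
  not exposed, has degree at least 2. The shortfalls are then cancelled by the sheltered vertices.
\<close>

lemma card_covered_plus_card_exposed_le:
  "card (\<Union>C) + card (exposed G C) \<le> 2 * card C"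
proof -
  have count: "(\<Sum>v\<in>\<Union>C. of_bool (v \<in> S)) = card S" if "S \<subseteq> \<Union>C" for S
    using that finite_covered by (simp add: of_bool_def sum.If_cases Int_absorb1)
  have sub: "exposed_leaves G C \<subseteq> \<Union>C" "sheltered G C \<subseteq> \<Union>C"
    using exposed_subset_covered by (auto simp: exposed_leaves_def sheltered_def)
  have "card (\<Union>C) + card (exposed G C) + card (sheltered G C)
      = (\<Sum>v\<in>\<Union>C. 1 + of_bool (v \<in> exposed G C) + of_bool (v \<in> sheltered G C))"
    by (simp only: sum.distrib count[OF exposed_subset_covered] count[OF sub(2)] card_eq_sum)
  also have "\<dots> \<le> (\<Sum>v\<in>\<Union>C. card (incident C v) + of_bool (v \<in> exposed_leaves G C))"
  proof (rule sum_mono)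
    fix v assume "v \<in> \<Union>C"
    then have "card (incident C v) \<noteq> 0"
      using finite_incident by (simp add: incident_eq_empty_iff)
    then show "1 + of_bool (v \<in> exposed G C) + of_bool (v \<in> sheltered G C)
        \<le> card (incident C v) + of_bool (v \<in> exposed_leaves G C)"
      by (auto simp: exposed_leaves_def sheltered_def)
  qed
  also have "\<dots> = 2 * card C + card (exposed_leaves G C)"
    by (simp only: sum.distrib sum_card_incident[OF code_subset] count[OF sub(1)])
  finally show ?thesis
    using card_exposed_leaves_le_card_sheltered by linarith
qed

lemma card_verts_le_twice_card_code:
  assumes "\<And>x. x \<in> pverts G \<Longrightarrow> \<exists>w. (x, w) \<in> parcs G"
  shows "card (pverts G) \<le> 2 * card C"
proof -
  have "card (pverts G) = card (\<Union>C) + card (pverts G - \<Union>C)"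
    using covered_subset_verts pair_finite_verts finite_covered
    by (simp add: card_Diff_subset card_mono)
  also have "\<dots> \<le> card (\<Union>C) + card (exposed G C)"
    using card_uncovered_le_card_exposed[OF assms] by simp
  also have "\<dots> \<le> 2 * card C"
    by (rule card_covered_plus_card_exposed_le)
  finally show ?thesis .
qed

end

section \<open>The lower bound\<close>

theorem theorem12:
  fixes G :: "'a pair_pre_digraph"
  assumes "pair_graph G" and "edges G \<noteq> {}"
    and "Digraph_Component.connected (with_proj G)"
    and "pendant_free G"
  shows "real (eid_number G) \<ge> real (card (pverts G)) / 2"
proof -
  interpret pair_graph G by fact
  have "\<exists>k C. edge_identifying_code G C \<and> card C = k"
    using assms(4) pendant_free_iff_code by blast
  from LeastI_ex[OF this] obtain C where C: "edge_identifying_code G C" "card C = eid_number G"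
    unfolding eid_number_def by blast
  interpret edge_coded_graph G C
    by unfold_locales (rule C(1))
  have "card (pverts G) \<le> 2 * card C"
    using connected_no_isolated[OF assms(3,2)] by (intro card_verts_le_twice_card_code) blast
  then show ?thesis using C(2) by simp
qed

end
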